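(* In the graceful game on a wheel $W_n$, $n\geq 3$, if Bob is the first player then Bob has a winning strategy.
   Context: The wheel $W_n$ ($n\geq 3$) is obtained from the cycle $(v_0,\dots,v_{n-1})$ by adding a central vertex $v_n$ adjacent to all $v_0,\dots,v_{n-1}$; it has $n+1$ vertices and $2n$ edges. A graceful labeling of a graph $G$ with $m$ edges is an injective map $f\colon V(G)\to\{0,1,\dots,m\}$ such that the induced edge labels $|f(u)-f(v)|$, $uv\in E(G)$, are pairwise distinct. The graceful game on a simple graph $G$ with $m$ edges: two players, Alice and Bob, alternately choose a free (not yet labeled) vertex and assign to it a label from $\{0,1,\dots,m\}$ not yet used. An edge both of whose endpoints are labeled gets label $|f(u)-f(v)|$; a move is legal only if after it all edge labels are pairwise distinct. Alice wins if the whole graph ends up gracefully labeled; Bob wins if he can prevent this. *)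

theory Defs
  imports Main
begin

text \<open>A finite simple graph is a pair \<open>(V, E)\<close> of a vertex set and a set of two-element edges.\<close>

type_synonym 'a graph = "'a set \<times> 'a set set"

definition verts :: "'a graph \<Rightarrow> 'a set" where
  "verts G = fst G"

definition edges :: "'a graph \<Rightarrow> 'a set set" where
  "edges G = snd G"

definition wheel :: "nat \<Rightarrow> nat graph" where
  "wheel n = ({0..n}, {{i, (i + 1) mod n} | i. i < n} \<union> {{i, n} | i. i < n})"

definition distinct_edge_labels :: "'a set set \<Rightarrow> ('a \<Rightarrow> nat) \<Rightarrow> bool" where
  "distinct_edge_labels E f \<longleftrightarrow>
     (\<forall>u v x y. {u, v} \<in> E \<and> {x, y} \<in> E \<and> {u, v} \<noteq> {x, y} \<longrightarrow>
        \<bar>int (f u) - int (f v)\<bar> \<noteq> \<bar>int (f x) - int (f y)\<bar>)"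

definition graceful_labeling :: "'a graph \<Rightarrow> ('a \<Rightarrow> nat) \<Rightarrow> bool" where
  "graceful_labeling G f \<longleftrightarrow>
     inj_on f (verts G) \<and> f ` verts G \<subseteq> {0..card (edges G)} \<and> distinct_edge_labels (edges G) f"

text \<open>A position is a partial labeling; a move \<open>(v, l)\<close> assigns the label \<open>l\<close> to the vertex \<open>v\<close>;
  a play is recorded as the list of the moves made so far, in chronological order.\<close>

type_synonym 'a position = "'a \<Rightarrow> nat option"
type_synonym 'a move = "'a \<times> nat"
type_synonym 'a play = "'a move list"

definition apply_move :: "'a position \<Rightarrow> 'a move \<Rightarrow> 'a position" where
  "apply_move p mv = p(fst mv \<mapsto> snd mv)"

definition position_after :: "'a play \<Rightarrow> 'a position" where
  "position_after h = foldl apply_move Map.empty h"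

definition legal_move :: "'a graph \<Rightarrow> 'a position \<Rightarrow> 'a move \<Rightarrow> bool" where
  "legal_move G p mv \<longleftrightarrow>
     fst mv \<in> verts G \<and> fst mv \<notin> dom p \<and>
     snd mv \<in> {0..card (edges G)} \<and> snd mv \<notin> ran p \<and>
     (let q = apply_move p mv
      in distinct_edge_labels {e \<in> edges G. e \<subseteq> dom q} (\<lambda>v. the (q v)))"

definition legal_play :: "'a graph \<Rightarrow> 'a play \<Rightarrow> bool" where
  "legal_play G h \<longleftrightarrow> (\<forall>k < length h. legal_move G (position_after (take k h)) (h ! k))"

definition finished :: "'a graph \<Rightarrow> 'a play \<Rightarrow> bool" where
  "finished G h \<longleftrightarrow> (\<nexists>mv. legal_move G (position_after h) mv)"

datatype player = Alice | Bob

fun opponent :: "player \<Rightarrow> player" where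
  "opponent Alice = Bob"
| "opponent Bob = Alice"

definition to_move :: "player \<Rightarrow> 'a play \<Rightarrow> player" where
  "to_move first h = (if even (length h) then first else opponent first)"

text \<open>The winner of a finished play. A play that gets stuck with free vertices left is won by Bob.\<close>

definition winner :: "'a graph \<Rightarrow> 'a play \<Rightarrow> player" where
  "winner G h =
     (if dom (position_after h) = verts G \<and> graceful_labeling G (\<lambda>v. the (position_after h v))
      then Alice else Bob)"

type_synonym 'a strategy = "'a play \<Rightarrow> 'a move"

definition consistent_with :: "player \<Rightarrow> player \<Rightarrow> 'a strategy \<Rightarrow> 'a play \<Rightarrow> bool" where
  "consistent_with first P s h \<longleftrightarrow>
     (\<forall>k < length h. to_move first (take k h) = P \<longrightarrow> h ! k = s (take k h))"

text \<open>The first conjunct forces the strategy to make a legal move whenever one exists. Without it, an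
  illegal reply would leave no finished consistent play and make the second conjunct vacuous.\<close>

definition winning_strategy :: "'a graph \<Rightarrow> player \<Rightarrow> player \<Rightarrow> 'a strategy \<Rightarrow> bool" where
  "winning_strategy G first P s \<longleftrightarrow>
     (\<forall>h. legal_play G h \<and> consistent_with first P s h \<and> to_move first h = P \<and> \<not> finished G h
        \<longrightarrow> legal_move G (position_after h) (s h)) \<and>
     (\<forall>h. legal_play G h \<and> consistent_with first P s h \<and> finished G h \<longrightarrow> winner G h = P)"

definition has_winning_strategy :: "'a graph \<Rightarrow> player \<Rightarrow> player \<Rightarrow> bool" where
  "has_winning_strategy G first P \<longleftrightarrow> (\<exists>s. winning_strategy G first P s)"

end

theory Submission
  imports Defs
begin

text \<open>Bob opens by giving the hub the label \<open>n\<close>. A graceful labeling uses every edge label in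
  \<open>{1..2n}\<close>, and the edge label \<open>2n\<close> forces the labels \<open>0\<close> and \<open>2n\<close> onto adjacent vertices. As the
  hub has neither of them, both lie on the rim, and then their two spokes have the same edge label
  \<open>n\<close>. So after the opening no play ends in a graceful labeling, and Bob may move arbitrarily.\<close>

text \<open>By counting: the \<open>m\<close> edges carry distinct labels, nonzero by injectivity of
  \<open>f\<close> and at most \<open>m\<close>, so these labels exhaust \<open>{1..m}\<close>.
  Since vertex labels lie in \<open>{0..m}\<close>, a difference of \<open>m\<close> can only come
  from \<open>0\<close> and \<open>m\<close>.\<close>

lemma graceful_labeling_extreme_edge:
  assumes gr: "graceful_labeling G f"
    and simple: "\<And>e. e \<in> edges G \<Longrightarrow> \<exists>u v. e = {u, v} \<and> u \<noteq> v \<and> u \<in> verts G \<and> v \<in> verts G"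
    and pos: "card (edges G) > 0"
  obtains u v where "{u, v} \<in> edges G" "f u = 0" "f v = card (edges G)"
proof -
  define m where "m = card (edges G)"
  \<comment> \<open>Writing the label as maximum minus minimum makes it a function of the edge as a
    set, so no order of its ends has to be chosen.\<close>
  define lab where "lab e = nat (int (Max (f ` e)) - int (Min (f ` e)))" for e
  have lab: "int (lab {u, v}) = \<bar>int (f u) - int (f v)\<bar>" for u v
    by (auto simp: lab_def max_def min_def)
  have inj: "inj_on f (verts G)" and ran: "f ` verts G \<subseteq> {0..m}"
    and dist: "distinct_edge_labels (edges G) f"
    using gr by (auto simp: graceful_labeling_def m_def)
  have "inj_on lab (edges G)"
  proof (rule inj_onI)
    fix e e' assume e: "e \<in> edges G" "e' \<in> edges G" "lab e = lab e'"
    obtain u v x y where "e = {u, v}" "e' = {x, y}" using simple e(1,2) by meson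
    with e lab[of u v] lab[of x y] dist show "e = e'"
      unfolding distinct_edge_labels_def by metis
  qed
  then have card: "card (lab ` edges G) = card {1..m}"
    by (simp add: card_image m_def)
  have "lab ` edges G \<subseteq> {1..m}"
  proof
    fix k assume "k \<in> lab ` edges G"
    then obtain u v where uv: "k = lab {u, v}" "u \<noteq> v" "u \<in> verts G" "v \<in> verts G"
      using simple by blast
    then have "f u \<noteq> f v" "f u \<le> m" "f v \<le> m" using inj ran by (auto dest: inj_onD)
    with lab[of u v] uv(1) show "k \<in> {1..m}" by auto
  qed
  with card have "lab ` edges G = {1..m}" by (simp add: card_subset_eq)
  with pos have "m \<in> lab ` edges G" by (simp add: m_def)
  then obtain u v where uv: "m = lab {u, v}" "{u, v} \<in> edges G" "u \<in> verts G" "v \<in> verts G"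
    using simple by blast
  then have "f u \<le> m" "f v \<le> m" using ran by auto
  with lab[of u v] uv(1) have "f u = 0 \<and> f v = m \<or> f v = 0 \<and> f u = m" by linarith
  then show thesis using that uv(2) by (metis insert_commute m_def)
qed

lemma verts_wheel [simp]: "verts (wheel n) = {0..n}"
  by (simp add: verts_def wheel_def)

lemma edges_wheel:
  "edges (wheel n) = (\<lambda>i. {i, (i + 1) mod n}) ` {..<n} \<union> (\<lambda>i. {i, n}) ` {..<n}"
  by (auto simp: edges_def wheel_def)

lemma card_edges_wheel:
  assumes "n \<ge> 3"
  shows "card (edges (wheel n)) = 2 * n"
proof -
  \<comment> \<open>For \<open>n = 2\<close> this would fail: the two rim edges would
    coincide.\<close>
  have "inj_on (\<lambda>i. {i, (i + 1) mod n}) {..<n}"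
    using assms by (auto intro!: inj_onI simp: doubleton_eq_iff mod_Suc split: if_splits)
  moreover have "inj_on (\<lambda>i. {i, n}) {..<n}"
    by (auto intro!: inj_onI simp: doubleton_eq_iff)
  moreover have "(\<lambda>i. {i, (i + 1) mod n}) ` {..<n} \<inter> (\<lambda>i. {i, n}) ` {..<n} = {}"
    using assms by (auto simp: doubleton_eq_iff mod_Suc split: if_splits)
  ultimately show ?thesis
    by (simp add: edges_wheel card_Un_disjoint card_image)
qed

text \<open>The strict bound on \<open>u\<close> records that every edge has an end on the
  rim.\<close>

lemma edge_wheelE:
  assumes "n \<ge> 3" "e \<in> edges (wheel n)"
  obtains u v where "e = {u, v}" "u < n" "v \<le> n" "u \<noteq> v"
proof -
  have "i \<noteq> (i + 1) mod n \<and> (i + 1) mod n \<le> n" if "i < n" for i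
    using assms(1) that by (simp add: mod_Suc)
  then show thesis using assms(2) that by (auto simp: edges_wheel)
qed

lemma not_graceful_labeling_wheel_hub:
  assumes n: "n \<ge> 3" and hub: "f n = n"
  shows "\<not> graceful_labeling (wheel n) f"
proof
  assume gr: "graceful_labeling (wheel n) f"
  obtain u v where uv: "{u, v} \<in> edges (wheel n)" "f u = 0" "f v = 2 * n"
  proof (rule graceful_labeling_extreme_edge[OF gr])
    show "\<exists>u v. e = {u, v} \<and> u \<noteq> v \<and> u \<in> verts (wheel n) \<and> v \<in> verts (wheel n)"
      if "e \<in> edges (wheel n)" for e
      using edge_wheelE[OF n that] by (metis atLeastAtMost_iff less_imp_le verts_wheel zero_le)
  qed (use n in \<open>auto simp: card_edges_wheel\<close>)
  have "u \<le> n" "v \<le> n"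
    using edge_wheelE[OF n uv(1)] by (metis doubleton_eq_iff less_imp_le)+
  moreover have "u \<noteq> n" "v \<noteq> n" "u \<noteq> v" using uv hub n by auto
  ultimately have "{u, n} \<in> edges (wheel n)" "{v, n} \<in> edges (wheel n)" "{u, n} \<noteq> {v, n}"
    by (auto simp: edges_wheel doubleton_eq_iff)
  then have "\<bar>int (f u) - int (f n)\<bar> \<noteq> \<bar>int (f v) - int (f n)\<bar>"
    using gr unfolding graceful_labeling_def distinct_edge_labels_def by blast
  then show False using uv hub by simp
qed

text \<open>With only the hub labeled, no edge has both ends labeled, so distinctness of edge labels
  holds vacuously.\<close>

lemma legal_move_wheel_hub:
  assumes n: "n \<ge> 3"
  shows "legal_move (wheel n) Map.empty (n, n)"
proof -
  have "\<not> e \<subseteq> {n}" if "e \<in> edges (wheel n)" for e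
    using edge_wheelE[OF n that] by (metis insert_subset less_irrefl singletonD)
  then have "{e \<in> edges (wheel n). e \<subseteq> {n}} = {}" by blast
  then show ?thesis
    using n by (simp add: legal_move_def apply_move_def card_edges_wheel distinct_edge_labels_def)
qed

lemma position_after_Nil [simp]: "position_after [] = Map.empty"
  by (simp add: position_after_def)

lemma position_after_take_Suc:
  "k < length h \<Longrightarrow>
    position_after (take (Suc k) h) = apply_move (position_after (take k h)) (h ! k)"
  by (simp add: position_after_def take_Suc_conv_app_nth)

text \<open>A legal move goes to a free vertex, so it never overwrites an earlier label.\<close>

lemma legal_play_keeps_first_label:
  assumes "legal_play G h" "h \<noteq> []"
  shows "position_after h (fst (h ! 0)) = Some (snd (h ! 0))"
proof -
  \<comment> \<open>Induction over nonempty prefixes: the base case is the prefix consisting of the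
    first move alone.\<close>
  have "position_after (take (Suc k) h) (fst (h ! 0)) = Some (snd (h ! 0))"
    if "Suc k \<le> length h" for k
    using that
  proof (induction k)
    case 0
    then show ?case by (cases h) (simp_all add: position_after_def apply_move_def)
  next
    case (Suc k)
    then have "legal_move G (position_after (take (Suc k) h)) (h ! Suc k)"
      using assms(1) by (simp add: legal_play_def)
    then have "fst (h ! Suc k) \<notin> dom (position_after (take (Suc k) h))"
      by (simp add: legal_move_def)
    with Suc have "fst (h ! Suc k) \<noteq> fst (h ! 0)" by auto
    with Suc show ?case by (simp add: position_after_take_Suc apply_move_def)
  qed
  from this[of "length h - 1"] assms(2) show ?thesis by (simp add: Suc_le_eq)
qed

theorem theorem6:
  fixes n :: nat
  assumes "n \<ge> 3"
  shows "has_winning_strategy (wheel n) Bob Bob"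
proof -
  define s :: "nat strategy" where
    "s h = (if h = [] then (n, n) else SOME mv. legal_move (wheel n) (position_after h) mv)" for h
  note hub = legal_move_wheel_hub[OF assms]
  \<comment> \<open>In an unfinished play some legal move exists, so \<open>SOME\<close> returns
    one; the opening is legal by \<open>hub\<close>.\<close>
  have "legal_move (wheel n) (position_after h) (s h)" if "\<not> finished (wheel n) h" for h
    using that hub by (auto simp: s_def finished_def intro: someI)
  moreover have "winner (wheel n) h = Bob"
    if h: "legal_play (wheel n) h" "consistent_with Bob Bob s h" "finished (wheel n) h" for h
  proof -
    \<comment> \<open>The empty play is not finished, because the opening is available.\<close>
    have "h \<noteq> []" using h(3) hub by (auto simp: finished_def)
    then have "h ! 0 = (n, n)"
      using h(2) by (auto simp: consistent_with_def to_move_def s_def)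
    with legal_play_keeps_first_label[OF h(1) \<open>h \<noteq> []\<close>] have "position_after h n = Some n"
      by simp
    \<comment> \<open>Ruling out a graceful final labeling settles stuck and complete plays alike,
      since \<open>winner\<close> then yields \<open>Bob\<close> in both cases.\<close>
    then show ?thesis
      using not_graceful_labeling_wheel_hub[OF assms] by (simp add: winner_def)
  qed
  ultimately show ?thesis
    unfolding has_winning_strategy_def winning_strategy_def by blast
qed

end
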